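(* Let $f,c:\mathbb{R}^n\to\mathbb{R}$ be locally Lipschitz continuous, let $\emptyset\neq X\subseteq\mathbb{R}^n$ be convex and closed, let $\rho\ge0$, and let $H$ be the associated improvement function. Consider the problem $\min_{x\in X}f(x)$ s.t. $c(x)\le0$, let $\mathcal{M}=\min_{a\in A(\cdot)}\mathcal{M}_a$ be a model for $H$ satisfying the model requirements (stated in the context), and suppose that the subproblem $\min_{y\in X}\mathcal{M}(y;x^k)+\frac{\mu^k}{2}\|y-x^k\|^2$ is solvable for all $k$. Let $\{x^k\}_k$ be the sequence produced by the Algorithm described in the context with $\mathrm{Tol}=0$. Suppose furthermore that: (i) $\{x^k\}_k$ is bounded; (ii) there is a constant $\delta>0$ such that $\mu^{k+1}>\mu^k+\delta$ after every null step; (iii) for any cluster point $\bar x$ of $\{x^k\}_k$ there exists a subsequence $\{x^{k_i}\}_i$ such that $\lim_i x^{k_i}=\bar x$ and $$\operatorname{epi}\big(\bar{\mathcal{M}}(\cdot;\bar x)+\mathrm{i}_X\big)\subseteq\operatorname{LimInn}\Big(\operatorname{epi}\big(\mathcal{M}(\cdot;x^{k_i})+\mathrm{i}_X\big)\Big),\qquad \bar{\mathcal{M}}(\cdot;\bar x):=\min_{a\in A_H(\bar x)}\mathcal{M}_a(\cdot;\bar x).$$ Then every cluster point $\bar x$ of $\{x^k\}_k$ is M-critical, and it is FM-critical if $\bar x$ is feasible (i.e. $\bar x \in X$ and $c(\bar x)\le0$), which is certainly true if the starting point $x^0$ is feasible.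
   Context: Improvement function: $H(y;x)=\max\{f(y)-\tau_f(x),\,c(y)\}$ with $\tau_f(x)=f(x)+\rho\max\{c(x),0\}$, for a given parameter $\rho\ge0$. Model requirements: for every $x\in X$, $A(x)$ is a finite (nonempty) index set, and for every $a\in A(x)$ the function $\mathcal{M}_a(\cdot;x):\mathbb{R}^n\to\mathbb{R}$ is real-valued and convex. One sets $\mathcal{M}(\cdot;x):=\min_{a\in A(x)}\mathcal{M}_a(\cdot;x)$ and requires: (a) $\mathcal{M}(x;x)=H(x;x)$ for all $x\in X$; (b) there exists a constant $\bar\mu\in[0,+\infty)$ such that $H(y;x)\le\mathcal{M}(y;x)+\frac{\bar\mu}{2}\|y-x\|^2$ for all $x,y\in X$. (The value of $\bar \mu$ is not used by the algorithm.) Criticality: $A_H(\bar x):=\{a\in A(\bar x):\mathcal{M}_a(\bar x;\bar x)=H(\bar x;\bar x)\}$. A point $\bar x\in X$ is M-critical if $\bar x\in\arg\min_{x\in X}\mathcal{M}_a(x;\bar x)$ for all $a\in A_H(\bar x)$; it is FM-critical if in addition $c(\bar x)\le0$. Algorithm. Given $x^0\in X$, $\kappa\in(0,1)$, $\mu^0\ge\kappa$, $\lambda\in[0,\kappa)$ and a tolerance $\mathrm{Tol}\ge0$. For $k=0,1,2,\dots$: 1. Let $y^k\in X$ be an $\epsilon^k$-solution of $\min_{y\in X}\mathcal{M}(y;x^k)+\frac{\mu^k}{2}\|y-x^k\|^2$, i.e. a point of $X$ whose objective value is at most the minimum plus $\epsilon^k$, where $0\le\epsilon^k\le\frac{\lambda}{2}\|y^k-x^k\|^2$.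 2. If $\|y^k-x^k\|\le\mathrm{Tol}$, stop and return $x^k$. 3. If $H(y^k;x^k)\le H(x^k;x^k)-\frac{\kappa-\lambda}{2}\|y^k-x^k\|^2$ (serious step), set $x^{k+1}=y^k$ and $\mu^{k+1}=\mu^k$; otherwise (null step), set $x^{k+1}=x^k$ and choose $\mu^{k+1}>\mu^k$. Notation: $\mathrm{i}_X$ is the indicator function of $X$ ($0$ on $X$, $+\infty$ elsewhere); $\operatorname{epi}(\mathsf f)=\{(x,\alpha)\in\mathbb{R}^{n+1}:\mathsf f(x)\le\alpha\}$; for sets $D_i$, $\operatorname{LimInn}(D_i)$ is the set of all limits of convergent sequences $(z^i)_i$ with $z^i\in D_i$ for all $i$. $\|\cdot\|$ is the Euclidean norm. *)

theory Defs
  imports "HOL-Analysis.Analysis"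
begin

definition locally_lipschitz :: "('a::metric_space \<Rightarrow> 'b::metric_space) \<Rightarrow> bool" where
  "locally_lipschitz f \<longleftrightarrow> (\<forall>x. \<exists>r>0. \<exists>L. L-lipschitz_on (ball x r) f)"

section \<open>Improvement function and models\<close>

text \<open>Two-place functions such as \<open>H(y;x)\<close> take the evaluation point \<open>y\<close> first and the
  reference point \<open>x\<close> last.\<close>

definition tau :: "real \<Rightarrow> ('a \<Rightarrow> real) \<Rightarrow> ('a \<Rightarrow> real) \<Rightarrow> 'a \<Rightarrow> real" where
  "tau \<rho> f c x = f x + \<rho> * max (c x) 0"

definition improvement :: "real \<Rightarrow> ('a \<Rightarrow> real) \<Rightarrow> ('a \<Rightarrow> real) \<Rightarrow> 'a \<Rightarrow> 'a \<Rightarrow> real" where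
  "improvement \<rho> f c y x = max (f y - tau \<rho> f c x) (c y)"

text \<open>The family \<open>\<M>\<^sub>a(\<cdot>;x)\<close>, \<open>a \<in> A(x)\<close>, is given by \<open>Ma a y x\<close>; all index sets are
  subsets of one arbitrary type \<open>'i\<close>.\<close>

definition model_min :: "('i \<Rightarrow> 'a \<Rightarrow> 'a \<Rightarrow> real) \<Rightarrow> ('a \<Rightarrow> 'i set) \<Rightarrow> 'a \<Rightarrow> 'a \<Rightarrow> real" where
  "model_min Ma A y x = Min ((\<lambda>a. Ma a y x) ` A x)"

definition is_model ::
  "'a::real_normed_vector set \<Rightarrow> ('a \<Rightarrow> 'a \<Rightarrow> real) \<Rightarrow> ('i \<Rightarrow> 'a \<Rightarrow> 'a \<Rightarrow> real) \<Rightarrow> ('a \<Rightarrow> 'i set) \<Rightarrow> bool" where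
  "is_model X H Ma A \<longleftrightarrow>
     (\<forall>x\<in>X. finite (A x) \<and> A x \<noteq> {}) \<and>
     (\<forall>x\<in>X. \<forall>a\<in>A x. convex_on UNIV (\<lambda>y. Ma a y x)) \<and>
     (\<forall>x\<in>X. model_min Ma A x x = H x x) \<and>
     (\<exists>\<mu>bar\<ge>0. \<forall>x\<in>X. \<forall>y\<in>X. H y x \<le> model_min Ma A y x + \<mu>bar / 2 * (norm (y - x))\<^sup>2)"

definition active ::
  "('a \<Rightarrow> 'a \<Rightarrow> real) \<Rightarrow> ('i \<Rightarrow> 'a \<Rightarrow> 'a \<Rightarrow> real) \<Rightarrow> ('a \<Rightarrow> 'i set) \<Rightarrow> 'a \<Rightarrow> 'i set" where
  "active H Ma A x = {a \<in> A x. Ma a x x = H x x}"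

definition M_critical ::
  "'a set \<Rightarrow> ('a \<Rightarrow> 'a \<Rightarrow> real) \<Rightarrow> ('i \<Rightarrow> 'a \<Rightarrow> 'a \<Rightarrow> real) \<Rightarrow> ('a \<Rightarrow> 'i set) \<Rightarrow> 'a \<Rightarrow> bool" where
  "M_critical X H Ma A x \<longleftrightarrow>
     x \<in> X \<and> (\<forall>a \<in> active H Ma A x. is_arg_min (\<lambda>z. Ma a z x) (\<lambda>z. z \<in> X) x)"

definition FM_critical ::
  "'a set \<Rightarrow> ('a \<Rightarrow> real) \<Rightarrow> ('a \<Rightarrow> 'a \<Rightarrow> real) \<Rightarrow> ('i \<Rightarrow> 'a \<Rightarrow> 'a \<Rightarrow> real) \<Rightarrow> ('a \<Rightarrow> 'i set) \<Rightarrow> 'a \<Rightarrow> bool" where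
  "FM_critical X c H Ma A x \<longleftrightarrow> M_critical X H Ma A x \<and> c x \<le> 0"

definition feasible :: "'a set \<Rightarrow> ('a \<Rightarrow> real) \<Rightarrow> 'a \<Rightarrow> bool" where
  "feasible X c x \<longleftrightarrow> x \<in> X \<and> c x \<le> 0"

section \<open>The algorithm\<close>

text \<open>The parameter \<open>\<lambda>\<close> is written \<open>lam\<close>.  In this section \<open>M y x\<close> is the whole model \<open>\<M>(y;x)\<close>, and \<open>m\<close> is a value of the prox-parameter.\<close>

definition prox_objective :: "('a::real_normed_vector \<Rightarrow> 'a \<Rightarrow> real) \<Rightarrow> real \<Rightarrow> 'a \<Rightarrow> 'a \<Rightarrow> real" where
  "prox_objective M m x y = M y x + m / 2 * (norm (y - x))\<^sup>2"

definition solvable :: "'a set \<Rightarrow> ('a \<Rightarrow> real) \<Rightarrow> bool" where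
  "solvable X g \<longleftrightarrow> (\<exists>y. is_arg_min g (\<lambda>z. z \<in> X) y)"

definition eps_solution :: "'a set \<Rightarrow> ('a \<Rightarrow> real) \<Rightarrow> real \<Rightarrow> 'a \<Rightarrow> bool" where
  "eps_solution X g e y \<longleftrightarrow> y \<in> X \<and> (\<forall>z\<in>X. g y \<le> g z + e)"

definition descent_test ::
  "('a::real_normed_vector \<Rightarrow> 'a \<Rightarrow> real) \<Rightarrow> real \<Rightarrow> real \<Rightarrow> 'a \<Rightarrow> 'a \<Rightarrow> bool" where
  "descent_test H \<kappa> lam x y \<longleftrightarrow> H y x \<le> H x x - (\<kappa> - lam) / 2 * (norm (y - x))\<^sup>2"

definition stops_at :: "real \<Rightarrow> (nat \<Rightarrow> 'a::real_normed_vector) \<Rightarrow> (nat \<Rightarrow> 'a) \<Rightarrow> nat \<Rightarrow> bool" where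
  "stops_at Tol x y k \<longleftrightarrow> norm (y k - x k) \<le> Tol"

definition serious_step where
  "serious_step H \<kappa> lam Tol x y k \<longleftrightarrow> \<not> stops_at Tol x y k \<and> descent_test H \<kappa> lam (x k) (y k)"

definition null_step where
  "null_step H \<kappa> lam Tol x y k \<longleftrightarrow> \<not> stops_at Tol x y k \<and> \<not> descent_test H \<kappa> lam (x k) (y k)"

text \<open>A run is recorded by total sequences \<open>x\<close>, \<open>y\<close>, \<open>\<mu>\<close>, \<open>\<epsilon>\<close>.  A run that stops at iteration \<open>k\<close> is
  continued by repeating its final state forever.  Step 1 then holds at every index,
  and the only cluster point of a stopped run is the returned point \<open>x k\<close>.\<close>

definition algorithm_run ::
  "'a::real_normed_vector set \<Rightarrow> ('a \<Rightarrow> 'a \<Rightarrow> real) \<Rightarrow> ('a \<Rightarrow> 'a \<Rightarrow> real) \<Rightarrow> real \<Rightarrow> real \<Rightarrow> real \<Rightarrow>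
   (nat \<Rightarrow> 'a) \<Rightarrow> (nat \<Rightarrow> 'a) \<Rightarrow> (nat \<Rightarrow> real) \<Rightarrow> (nat \<Rightarrow> real) \<Rightarrow> bool" where
  "algorithm_run X H M \<kappa> lam Tol x y \<mu> \<epsilon> \<longleftrightarrow>
     0 < \<kappa> \<and> \<kappa> < 1 \<and> 0 \<le> lam \<and> lam < \<kappa> \<and> 0 \<le> Tol \<and> x 0 \<in> X \<and> \<kappa> \<le> \<mu> 0 \<and>
     (\<forall>k. 0 \<le> \<epsilon> k \<and> \<epsilon> k \<le> lam / 2 * (norm (y k - x k))\<^sup>2 \<and>
          eps_solution X (prox_objective M (\<mu> k) (x k)) (\<epsilon> k) (y k)) \<and>
     (\<forall>k. stops_at Tol x y k \<longrightarrow>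
          x (Suc k) = x k \<and> y (Suc k) = y k \<and> \<mu> (Suc k) = \<mu> k \<and> \<epsilon> (Suc k) = \<epsilon> k) \<and>
     (\<forall>k. serious_step H \<kappa> lam Tol x y k \<longrightarrow> x (Suc k) = y k \<and> \<mu> (Suc k) = \<mu> k) \<and>
     (\<forall>k. null_step H \<kappa> lam Tol x y k \<longrightarrow> x (Suc k) = x k \<and> \<mu> (Suc k) > \<mu> k)"

section \<open>Cluster points, epigraphs, inner limits\<close>

definition cluster_point :: "(nat \<Rightarrow> 'a::topological_space) \<Rightarrow> 'a \<Rightarrow> bool" where
  "cluster_point x z \<longleftrightarrow> (\<exists>r. strict_mono r \<and> (x \<circ> r) \<longlonglongrightarrow> z)"

text \<open>The indicator function of convex analysis, not the 0/1-valued \<^const>\<open>indicator\<close>.\<close>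

definition ind_fun :: "'a set \<Rightarrow> 'a \<Rightarrow> ereal" where
  "ind_fun X x = (if x \<in> X then 0 else \<infinity>)"

definition epi :: "('a \<Rightarrow> ereal) \<Rightarrow> ('a \<times> real) set" where
  "epi g = {(x, \<alpha>). g x \<le> ereal \<alpha>}"

lemma epi_plus_ind_fun: "epi (\<lambda>z. ereal (g z) + ind_fun X z) = epigraph X g"
  by (auto simp: epi_def ind_fun_def epigraph_def split: if_splits)

definition LimInn :: "(nat \<Rightarrow> 'a::topological_space set) \<Rightarrow> 'a set" where
  "LimInn D = {l. \<exists>z. (\<forall>i. z i \<in> D i) \<and> z \<longlonglongrightarrow> l}"

end

theory Submission
  imports Defs
begin

text \<open>
  Comparing the subproblem value at \<open>y\<close> with that at \<open>x\<close> shows that the descent test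
  holds as soon as \<open>\<mu> \<ge> \<mu>bar + \<kappa>\<close>, so there are finitely many null steps and \<open>\<mu>\<close> is
  eventually constant.  Since \<open>H(x;x) = max (c x) 0\<close>, the remaining steps decrease \<open>f\<close> (once an
  iterate satisfies the constraint) or \<open>c\<close> (while none does) by a multiple of \<open>\<parallel>y - x\<parallel>\<^sup>2\<close>;
  hence \<open>y - x\<close> tends to 0.  Passing to the limit in the subproblems through
  recovery sequences supplied by the inner limit, \<open>xbar\<close> minimises
  \<open>\<M>\<^sub>a(z;xbar) + \<mu>/2 \<parallel>z - xbar\<parallel>\<^sup>2\<close> over \<open>X\<close> for each active \<open>a\<close>, and by convexity the
  quadratic term can be dropped.
\<close>

section \<open>Continuity, convexity and real sequences\<close>

lemma locally_lipschitz_imp_isCont: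
  assumes "locally_lipschitz f"
  shows "isCont f x"
proof -
  obtain r L where "r > 0" and "L-lipschitz_on (ball x r) f"
    using assms unfolding locally_lipschitz_def by blast
  then have "continuous_on (ball x r) f"
    using lipschitz_on_continuous_on by blast
  then show ?thesis
    using \<open>r > 0\<close> by (simp add: continuous_on_eq_continuous_at)
qed

lemma isCont_bdd_below_range:
  fixes g :: "'a::heine_borel \<Rightarrow> real"
  assumes "\<And>z. isCont g z" and "bounded (range x)"
  shows "\<exists>b. \<forall>k. b \<le> g (x k)"
proof -
  have "compact (g ` closure (range x))"
    using assms by (intro compact_continuous_image continuous_at_imp_continuous_on)
      (auto simp: compact_closure)
  then have "bdd_below (g ` closure (range x))"
    by (intro bounded_imp_bdd_below compact_imp_bounded)
  then obtain b where "\<And>v. v \<in> g ` closure (range x) \<Longrightarrow> b \<le> v"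
    unfolding bdd_below_def by blast
  then show ?thesis
    using closure_subset[of "range x"] by blast
qed

text \<open>The first argument of the maximum is \<open>- \<rho> * max (c x) 0\<close>: it is 0 when
  \<open>c x \<le> 0\<close>, and otherwise it is at most 0 and so below \<open>c x\<close>.\<close>

lemma improvement_diag:
  assumes "\<rho> \<ge> 0"
  shows "improvement \<rho> f c x x = max (c x) 0"
proof -
  have "\<rho> * max (c x) 0 \<ge> 0" using assms by simp
  then show ?thesis
    unfolding improvement_def tau_def by (cases "c x \<le> 0") auto
qed

text \<open>On the segment from \<open>x\<close> towards \<open>z\<close>, the change of
  \<open>g\<close> is bounded linearly in the step length \<open>t\<close>, whereas the quadratic
  term is of order \<open>t\<^sup>2\<close>. Dividing by \<open>t\<close> and letting
  \<open>t\<close> tend to 0 removes the latter.\<close>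

lemma convex_prox_minimizer_imp_minimizer:
  fixes g :: "'a::real_normed_vector \<Rightarrow> real"
  assumes cg: "convex_on X g" and x: "x \<in> X" and z: "z \<in> X"
    and prox: "\<And>w. w \<in> X \<Longrightarrow> g x \<le> g w + m / 2 * (norm (w - x))\<^sup>2"
  shows "g x \<le> g z"
proof -
  define C where "C = m / 2 * (norm (z - x))\<^sup>2"
  have ineq: "g x \<le> g z + t * C" if t: "0 < t" "t < 1" for t
  proof -
    define w where "w = (1 - t) *\<^sub>R x + t *\<^sub>R z"
    have wX: "w \<in> X"
      using convex_on_imp_convex[OF cg] x z t unfolding w_def convex_alt by simp
    have "w - x = t *\<^sub>R (z - x)"
      by (simp add: w_def algebra_simps)
    then have "(norm (w - x))\<^sup>2 = t\<^sup>2 * (norm (z - x))\<^sup>2"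
      by (simp add: power_mult_distrib)
    then have "m / 2 * (norm (w - x))\<^sup>2 = t * (t * C)"
      by (simp add: C_def power2_eq_square)
    moreover have "g w \<le> (1 - t) * g x + t * g z"
      unfolding w_def using convex_onD[OF cg, of t x z] x z t by simp
    ultimately have "t * g x \<le> t * (g z + t * C)"
      using prox[OF wX] by (simp add: algebra_simps)
    then show ?thesis using t by simp
  qed
  have "((\<lambda>t. g z + t * C) \<longlongrightarrow> g z + 0 * C) (at_right 0)"
    by (intro tendsto_intros)
  moreover have "\<forall>\<^sub>F t in at_right (0::real). g x \<le> g z + t * C"
    using ineq by (auto simp: eventually_at_right_field intro!: exI[of _ 1])
  ultimately show ?thesis
    using tendsto_lowerbound[of "\<lambda>t. g z + t * C" _ "at_right 0" "g x"] by simp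
qed

lemma incseq_jumps_unbounded:
  fixes \<mu> :: "nat \<Rightarrow> real"
  assumes inc: "incseq \<mu>" and "\<delta> > 0" and inf: "\<exists>\<^sub>\<infinity>k. P k"
    and jump: "\<And>k. P k \<Longrightarrow> \<mu> k + \<delta> < \<mu> (Suc k)"
  shows "\<exists>k. B \<le> \<mu> k"
proof -
  \<comment> \<open>The bound reached after \<open>n\<close> jumps; monotonicity preserves it until
    the next jump.\<close>
  have "\<exists>k. \<mu> 0 + real n * \<delta> \<le> \<mu> k" for n
  proof (induction n)
    case (Suc n)
    then obtain k where k: "\<mu> 0 + real n * \<delta> \<le> \<mu> k" by blast
    obtain l where "l > k" "P l" using inf by (auto simp: INFM_nat)
    then have "\<mu> k \<le> \<mu> l" and "\<mu> l + \<delta> < \<mu> (Suc l)"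
      using inc jump by (auto simp: incseq_def)
    then have "\<mu> 0 + real (Suc n) * \<delta> \<le> \<mu> (Suc l)"
      using k by (simp add: algebra_simps)
    then show ?case by blast
  qed auto
  moreover obtain n where "B - \<mu> 0 < real n * \<delta>"
    using reals_Archimedean3[OF \<open>\<delta> > 0\<close>] by blast
  ultimately show ?thesis
    by (smt (verit))
qed

text \<open>From \<open>K\<close> on, \<open>V\<close> is nonincreasing and bounded below, hence
  convergent; its consecutive differences dominate \<open>\<alpha> * e k\<close> and tend to
  0.\<close>

lemma decrease_imp_tendsto_zero:
  fixes V e :: "nat \<Rightarrow> real"
  assumes "\<alpha> > 0" and e: "\<And>k. 0 \<le> e k" and V: "\<And>k. K \<le> k \<Longrightarrow> V (Suc k) \<le> V k - \<alpha> * e k"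
    and b: "\<And>k. K \<le> k \<Longrightarrow> b \<le> V k"
  shows "e \<longlonglongrightarrow> 0"
proof -
  define W where "W n = V (n + K)" for n
  have dec: "W (Suc n) \<le> W n - \<alpha> * e (n + K)" for n
    using V[of "n + K"] by (simp add: W_def)
  have "W (Suc n) \<le> W n" for n
    using dec[of n] mult_nonneg_nonneg[of \<alpha> "e (n + K)"] e[of "n + K"] \<open>\<alpha> > 0\<close> by linarith
  then have "decseq W" by (simp add: decseq_Suc_iff)
  moreover have "b \<le> W n" for n using b by (simp add: W_def)
  ultimately obtain l where l: "W \<longlonglongrightarrow> l"
    using decseq_convergent[of W b] by blast
  have "(\<lambda>n. (W n - W (Suc n)) / \<alpha>) \<longlonglongrightarrow> (l - l) / \<alpha>"
    using \<open>\<alpha> > 0\<close> by (intro tendsto_intros l LIMSEQ_Suc[OF l]) simp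
  then have lim: "(\<lambda>n. (W n - W (Suc n)) / \<alpha>) \<longlonglongrightarrow> 0" by simp
  have upper: "e (n + K) \<le> (W n - W (Suc n)) / \<alpha>" for n
    using dec[of n] \<open>\<alpha> > 0\<close> by (simp add: field_simps)
  have "(\<lambda>n. e (n + K)) \<longlonglongrightarrow> 0"
    by (rule tendsto_sandwich[OF _ _ tendsto_const lim]) (auto simp: e upper)
  then show ?thesis by (rule LIMSEQ_offset)
qed

section \<open>Descent test and finiteness of null steps\<close>

lemma eps_solution_descent:
  assumes sol: "eps_solution X (prox_objective M m x) e y"
    and e: "e \<le> lam / 2 * (norm (y - x))\<^sup>2" and x: "x \<in> X" and "M x x = H x x"
    and "H y x \<le> M y x + \<mu>bar / 2 * (norm (y - x))\<^sup>2" and "\<mu>bar + \<kappa> \<le> m"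
  shows "descent_test H \<kappa> lam x y"
proof -
  \<comment> \<open>The competitor is \<open>x\<close> itself, where the quadratic term
    vanishes.\<close>
  have "M y x + m / 2 * (norm (y - x))\<^sup>2 \<le> M x x + e"
    using sol x unfolding eps_solution_def prox_objective_def by fastforce
  moreover have "(\<mu>bar + \<kappa>) / 2 * (norm (y - x))\<^sup>2 \<le> m / 2 * (norm (y - x))\<^sup>2"
    using assms(6) by (intro mult_right_mono) auto
  \<comment> \<open>In total \<open>H y x - H x x\<close> is at most
    \<open>(lam + \<mu>bar - m) / 2\<close> times the squared step, and
    \<open>m \<ge> \<mu>bar + \<kappa>\<close> turns this factor into at most
    \<open>- (\<kappa> - lam) / 2\<close>.\<close>
  ultimately show ?thesis
    using assms unfolding descent_test_def by (simp add: field_simps)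
qed

text \<open>With zero tolerance, stopping forces \<open>y k = x k\<close>, so the repeated states of
  a stopped run behave like serious steps of length 0. Finite and infinite runs can thus be treated
  together.\<close>

lemma not_null_step_Tol_0:
  assumes run: "algorithm_run X H M \<kappa> lam 0 x y \<mu> \<epsilon>"
    and "\<not> null_step H \<kappa> lam 0 x y k"
  shows "x (Suc k) = y k" "\<mu> (Suc k) = \<mu> k" "descent_test H \<kappa> lam (x k) (y k)"
proof -
  have "x (Suc k) = y k \<and> \<mu> (Suc k) = \<mu> k \<and> descent_test H \<kappa> lam (x k) (y k)"
  proof (cases "stops_at 0 x y k")
    case True
    then have "y k = x k" by (simp add: stops_at_def)
    then show ?thesis
      using run True unfolding algorithm_run_def descent_test_def by auto
  next
    case False
    then have "serious_step H \<kappa> lam 0 x y k"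
      using assms(2) by (simp add: serious_step_def null_step_def)
    then show ?thesis
      using run unfolding algorithm_run_def serious_step_def by blast
  qed
  then show "x (Suc k) = y k" "\<mu> (Suc k) = \<mu> k" "descent_test H \<kappa> lam (x k) (y k)"
    by auto
qed

lemma algorithm_run_null_step:
  assumes "algorithm_run X H M \<kappa> lam Tol x y \<mu> \<epsilon>" and "null_step H \<kappa> lam Tol x y k"
  shows "x (Suc k) = x k" "\<mu> k < \<mu> (Suc k)"
  using assms unfolding algorithm_run_def by auto

lemma algorithm_run_in_X:
  assumes run: "algorithm_run X H M \<kappa> lam 0 x y \<mu> \<epsilon>"
  shows "x k \<in> X" "y k \<in> X"
proof -
  show y: "y k \<in> X" for k
    using run unfolding algorithm_run_def eps_solution_def by blast
  show "x k \<in> X"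
  proof (cases k)
    case 0
    then show ?thesis using run by (simp add: algorithm_run_def)
  next
    case (Suc l)
    have "x l \<in> X" for l
    proof (induction l)
      case (Suc l)
      then show ?case
        using algorithm_run_null_step[OF run, of l] not_null_step_Tol_0[OF run, of l] y by metis
    qed (use run in \<open>simp add: algorithm_run_def\<close>)
    then show ?thesis .
  qed
qed

lemma eventually_no_null_step:
  assumes model: "is_model X H Ma A"
    and run: "algorithm_run X H (model_min Ma A) \<kappa> lam 0 x y \<mu> \<epsilon>"
    and "\<delta> > 0" and jump: "\<And>k. null_step H \<kappa> lam 0 x y k \<Longrightarrow> \<mu> (Suc k) > \<mu> k + \<delta>"
  shows "\<exists>K. \<forall>k\<ge>K. \<not> null_step H \<kappa> lam 0 x y k"
proof (rule ccontr)
  assume "\<not> ?thesis"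
  then have often: "\<exists>\<^sub>\<infinity>k. null_step H \<kappa> lam 0 x y k"
    by (auto simp: INFM_nat_le)
  obtain \<mu>bar where \<mu>bar:
    "\<And>x y. x \<in> X \<Longrightarrow> y \<in> X \<Longrightarrow> H y x \<le> model_min Ma A y x + \<mu>bar / 2 * (norm (y - x))\<^sup>2"
    using model unfolding is_model_def by blast
  have inc: "incseq \<mu>"
  proof (rule incseq_SucI)
    show "\<mu> k \<le> \<mu> (Suc k)" for k
      using algorithm_run_null_step[OF run, of k] not_null_step_Tol_0[OF run, of k] by fastforce
  qed
  then obtain k where k: "\<mu>bar + \<kappa> \<le> \<mu> k"
    using incseq_jumps_unbounded[OF inc \<open>\<delta> > 0\<close> often jump] by blast
  \<comment> \<open>A null step after \<open>\<mu>\<close> has passed the threshold: it would have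
    to pass the descent test.\<close>
  obtain l where l: "l \<ge> k" "null_step H \<kappa> lam 0 x y l"
    using often by (auto simp: INFM_nat_le)
  have "\<mu>bar + \<kappa> \<le> \<mu> l" using k inc l(1) by (meson incseq_def order_trans)
  then have "descent_test H \<kappa> lam (x l) (y l)"
    using run model \<mu>bar algorithm_run_in_X[OF run]
    by (intro eps_solution_descent[where M = "model_min Ma A" and m = "\<mu> l" and e = "\<epsilon> l"])
      (auto simp: algorithm_run_def is_model_def)
  then show False using l by (simp add: null_step_def)
qed

section \<open>Decrease of objective and constraint, vanishing steps\<close>

text \<open>A bound on a maximum bounds both arguments. When \<open>c x \<le> 0\<close>, the penalty
  in \<open>tau\<close> vanishes and \<open>H(x;x) = 0\<close>, so the first argument becomes
  \<open>f y - f x\<close>.\<close>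

lemma descent_test_improvement:
  assumes "\<rho> \<ge> 0" and "descent_test (improvement \<rho> f c) \<kappa> lam x y"
  shows "c y \<le> max (c x) 0 - (\<kappa> - lam) / 2 * (norm (y - x))\<^sup>2"
    and "c x \<le> 0 \<Longrightarrow> f y \<le> f x - (\<kappa> - lam) / 2 * (norm (y - x))\<^sup>2"
  using assms(2) unfolding descent_test_def improvement_diag[OF assms(1)]
  by (auto simp: improvement_def tau_def)

lemma constraint_satisfied_persists:
  assumes run: "algorithm_run X (improvement \<rho> f c) M \<kappa> lam 0 x y \<mu> \<epsilon>" and "\<rho> \<ge> 0"
    and "c (x k) \<le> 0" and "k \<le> l"
  shows "c (x l) \<le> 0"
  using \<open>k \<le> l\<close>
proof (induction l rule: dec_induct)
  case (step l)
  show ?case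
  proof (cases "null_step (improvement \<rho> f c) \<kappa> lam 0 x y l")
    case True
    then show ?thesis using algorithm_run_null_step(1)[OF run True] step by simp
  next
    case False
    have "lam < \<kappa>" using run by (simp add: algorithm_run_def)
    then have "(\<kappa> - lam) / 2 * (norm (y l - x l))\<^sup>2 \<ge> 0" by simp
    then show ?thesis
      using descent_test_improvement(1)[OF \<open>\<rho> \<ge> 0\<close> not_null_step_Tol_0(3)[OF run False]]
        not_null_step_Tol_0(1)[OF run False] step.IH by simp
  qed
qed (use assms in simp)

lemma steps_tendsto_zero:
  fixes f c :: "'a::{real_normed_vector,heine_borel} \<Rightarrow> real"
  assumes run: "algorithm_run X (improvement \<rho> f c) M \<kappa> lam 0 x y \<mu> \<epsilon>" and "\<rho> \<ge> 0"
    and f: "\<And>z. isCont f z" and bnd: "bounded (range x)"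
    and K: "\<And>k. K \<le> k \<Longrightarrow> \<not> null_step (improvement \<rho> f c) \<kappa> lam 0 x y k"
  shows "(\<lambda>k. y k - x k) \<longlonglongrightarrow> 0"
proof -
  have \<alpha>: "(\<kappa> - lam) / 2 > 0" using run by (simp add: algorithm_run_def)
  note step = not_null_step_Tol_0[OF run K]
  have cdec: "c (x (Suc k)) \<le> max (c (x k)) 0 - (\<kappa> - lam) / 2 * (norm (y k - x k))\<^sup>2"
    and fdec: "c (x k) \<le> 0 \<Longrightarrow> f (x (Suc k)) \<le> f (x k) - (\<kappa> - lam) / 2 * (norm (y k - x k))\<^sup>2"
    if "K \<le> k" for k
    using descent_test_improvement[OF \<open>\<rho> \<ge> 0\<close> step(3)[OF that]] step(1)[OF that] by auto
  have "(\<lambda>k. (norm (y k - x k))\<^sup>2) \<longlonglongrightarrow> 0"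
  proof (cases "\<exists>k\<ge>K. c (x k) \<le> 0")
    case True
    then obtain L where L: "L \<ge> K" "c (x L) \<le> 0" by blast
    \<comment> \<open>Here \<open>f\<close> is the decreasing quantity, starting from
      \<open>L\<close> rather than \<open>K\<close>; continuity on the bounded range supplies its
      lower bound.\<close>
    obtain b where "\<And>k. b \<le> f (x k)"
      using isCont_bdd_below_range[OF f bnd] by blast
    then show ?thesis
      using fdec constraint_satisfied_persists[OF run \<open>\<rho> \<ge> 0\<close> L(2)] L(1)
      by (intro decrease_imp_tendsto_zero[OF \<alpha>, where V = "\<lambda>k. f (x k)" and K = L and b = b]) auto
  next
    case False
    \<comment> \<open>Here \<open>c\<close> itself decreases: on the tail
      \<open>max (c (x k)) 0 = c (x k)\<close>, and 0 is a lower bound.\<close>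
    then have pos: "c (x k) > 0" if "K \<le> k" for k using that by force
    show ?thesis
    proof (rule decrease_imp_tendsto_zero[OF \<alpha>, where V = "\<lambda>k. c (x k)" and K = K and b = 0])
      show "c (x (Suc k)) \<le> c (x k) - (\<kappa> - lam) / 2 * (norm (y k - x k))\<^sup>2" if "K \<le> k" for k
        using cdec[OF that] pos[OF that] by simp
    qed (use pos in \<open>auto intro: less_imp_le\<close>)
  qed
  then have "(\<lambda>k. sqrt ((norm (y k - x k))\<^sup>2)) \<longlonglongrightarrow> sqrt 0"
    by (rule tendsto_real_sqrt)
  then show ?thesis by (simp add: tendsto_norm_zero_iff)
qed

section \<open>Limits of the subproblems\<close>

text \<open>Each \<open>v i\<close> is compared with a recovery point for \<open>z\<close> in the
  subproblem at \<open>u i\<close>. The upper estimate of \<open>H\<close> by the model replaces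
  \<open>M (v i) (u i)\<close> by a quantity with a known limit, so no convergence of model values
  is required.\<close>

lemma prox_inequality_limit:
  fixes f c :: "'a::real_normed_vector \<Rightarrow> real"
  assumes sol: "\<And>i. eps_solution X (prox_objective M (m i) (u i)) (e i) (v i)"
    and m: "\<forall>\<^sub>F i in sequentially. m i = m0"
    and e: "\<And>i. e i \<le> lam / 2 * (norm (v i - u i))\<^sup>2"
    and HM: "\<And>i. H (v i) (u i) \<le> M (v i) (u i) + \<mu>bar / 2 * (norm (v i - u i))\<^sup>2"
    and H: "(\<lambda>i. H (v i) (u i)) \<longlonglongrightarrow> h"
    and u: "u \<longlonglongrightarrow> xbar" and vu: "(\<lambda>i. v i - u i) \<longlonglongrightarrow> 0"
    and inner: "(z, \<alpha>) \<in> LimInn (\<lambda>i. epi (\<lambda>w. ereal (M w (u i)) + ind_fun X w))"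
  shows "h \<le> \<alpha> + m0 / 2 * (norm (z - xbar))\<^sup>2"
proof -
  obtain p where p: "\<And>i. p i \<in> epigraph X (\<lambda>w. M w (u i))" and plim: "p \<longlonglongrightarrow> (z, \<alpha>)"
    using inner unfolding LimInn_def epi_plus_ind_fun by blast
  \<comment> \<open>Points and heights of the recovery sequence; the heights bound the model values
    from above and converge to \<open>\<alpha>\<close>.\<close>
  define w a where "w i = fst (p i)" and "a i = snd (p i)" for i
  have wX: "w i \<in> X" and Ma: "M (w i) (u i) \<le> a i" for i
    using p[of i] by (auto simp: epigraph_def w_def a_def)
  have w: "w \<longlonglongrightarrow> z" and a: "a \<longlonglongrightarrow> \<alpha>"
    using tendsto_fst[OF plim] tendsto_snd[OF plim] by (simp_all add: w_def[abs_def] a_def[abs_def])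
  \<comment> \<open>In the coefficient of \<open>lo\<close>, \<open>m0\<close> comes from the prox
    term, \<open>\<mu>bar\<close> from passing from \<open>M\<close> to \<open>H\<close>, and
    \<open>lam\<close> from the inexactness \<open>e i\<close>. Its sign does not matter, since the
    squared step tends to 0.\<close>
  define lo up where
    "lo i = H (v i) (u i) + (m0 - \<mu>bar - lam) / 2 * (norm (v i - u i))\<^sup>2" and
    "up i = a i + m0 / 2 * (norm (w i - u i))\<^sup>2" for i
  have "lo i \<le> up i" if "m i = m0" for i
  proof -
    have "M (v i) (u i) + m0 / 2 * (norm (v i - u i))\<^sup>2
        \<le> M (w i) (u i) + m0 / 2 * (norm (w i - u i))\<^sup>2 + e i"
      using sol[of i] wX[of i] that unfolding eps_solution_def prox_objective_def by auto
    then show ?thesis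
      using HM[of i] e[of i] Ma[of i] unfolding lo_def up_def by (simp add: field_simps)
  qed
  then have le: "\<forall>\<^sub>F i in sequentially. lo i \<le> up i"
    using m by (auto elim: eventually_mono)
  have "lo \<longlonglongrightarrow> h"
    using tendsto_add[OF H tendsto_mult_left[OF tendsto_power[OF tendsto_norm[OF vu], of 2],
        of "(m0 - \<mu>bar - lam) / 2"]]
    unfolding lo_def by simp
  moreover have "up \<longlonglongrightarrow> \<alpha> + m0 / 2 * (norm (z - xbar))\<^sup>2"
    unfolding up_def by (intro tendsto_intros a w u)
  ultimately show ?thesis
    using le by (intro tendsto_le[OF sequentially_bot])
qed

lemma improvement_tendsto_diag:
  assumes "isCont f z" "isCont c z" and "(v \<longlongrightarrow> z) F" "(u \<longlongrightarrow> z) F"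
  shows "((\<lambda>i. improvement \<rho> f c (v i) (u i)) \<longlongrightarrow> improvement \<rho> f c z z) F"
  unfolding improvement_def tau_def
  by (intro tendsto_intros isCont_tendsto_compose[OF assms(1)] isCont_tendsto_compose[OF assms(2)]
      assms(3,4))

theorem theorem4p1:
  fixes f c :: "real ^ 'n \<Rightarrow> real"
    and X :: "(real ^ 'n) set"
    and \<rho> \<kappa> lam \<delta> :: real
    and H M :: "real ^ 'n \<Rightarrow> real ^ 'n \<Rightarrow> real"
    and Ma :: "'i \<Rightarrow> real ^ 'n \<Rightarrow> real ^ 'n \<Rightarrow> real"
    and A :: "real ^ 'n \<Rightarrow> 'i set"
    and x y :: "nat \<Rightarrow> real ^ 'n"
    and \<mu> \<epsilon> :: "nat \<Rightarrow> real"
  defines "H \<equiv> improvement \<rho> f c"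
    and "M \<equiv> model_min Ma A"
  assumes "locally_lipschitz f" and "locally_lipschitz c"
    and "X \<noteq> {}" and "convex X" and "closed X"
    and "\<rho> \<ge> 0"
    and "is_model X H Ma A"
    and "algorithm_run X H M \<kappa> lam 0 x y \<mu> \<epsilon>"
    and "\<And>k. solvable X (prox_objective M (\<mu> k) (x k))"
    and "bounded (range x)"
    and "\<delta> > 0" and "\<And>k. null_step H \<kappa> lam 0 x y k \<Longrightarrow> \<mu> (Suc k) > \<mu> k + \<delta>"
    and "\<And>xbar. cluster_point x xbar \<Longrightarrow>
           \<exists>r. strict_mono r \<and> (\<lambda>i. x (r i)) \<longlonglongrightarrow> xbar \<and>
             epi (\<lambda>z. ereal (Min ((\<lambda>a. Ma a z xbar) ` active H Ma A xbar)) + ind_fun X z)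
               \<subseteq> LimInn (\<lambda>i. epi (\<lambda>z. ereal (M z (x (r i))) + ind_fun X z))"
  shows "\<forall>xbar. cluster_point x xbar \<longrightarrow>
           M_critical X H Ma A xbar \<and>
           (feasible X c xbar \<longrightarrow> FM_critical X c H Ma A xbar) \<and>
           (feasible X c (x 0) \<longrightarrow> feasible X c xbar)"
proof (intro allI impI)
  note model = assms(9) and run = assms(10)
  have f: "isCont f z" and c: "isCont c z" for z
    using assms(3,4) locally_lipschitz_imp_isCont by blast+
  note inX = algorithm_run_in_X[OF run]
  obtain K where K: "\<And>k. K \<le> k \<Longrightarrow> \<not> null_step H \<kappa> lam 0 x y k"
    using eventually_no_null_step[OF model run[unfolded M_def] \<open>\<delta> > 0\<close> assms(14)] by blast
  have steps: "(\<lambda>k. y k - x k) \<longlonglongrightarrow> 0"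
    using steps_tendsto_zero[OF run[unfolded H_def] \<open>\<rho> \<ge> 0\<close> f \<open>bounded (range x)\<close>] K
    unfolding H_def by blast
  have \<mu>: "\<mu> k = \<mu> K" if "K \<le> k" for k
    using that by (induction k rule: dec_induct) (auto simp: not_null_step_Tol_0(2)[OF run K])
  obtain \<mu>bar where \<mu>bar:
    "\<And>x y. x \<in> X \<Longrightarrow> y \<in> X \<Longrightarrow> H y x \<le> M y x + \<mu>bar / 2 * (norm (y - x))\<^sup>2"
    using model unfolding is_model_def M_def by blast

  fix xbar
  assume "cluster_point x xbar"
  then obtain r where r: "strict_mono r" and lim: "(\<lambda>i. x (r i)) \<longlonglongrightarrow> xbar"
    and inner: "epi (\<lambda>z. ereal (Min ((\<lambda>a. Ma a z xbar) ` active H Ma A xbar)) + ind_fun X z)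
               \<subseteq> LimInn (\<lambda>i. epi (\<lambda>z. ereal (M z (x (r i))) + ind_fun X z))"
    using assms(15) by blast
  have xbar: "xbar \<in> X"
    using closed_sequentially[OF \<open>closed X\<close> _ lim] inX(1) by blast
  have ysteps: "(\<lambda>i. y (r i) - x (r i)) \<longlonglongrightarrow> 0"
    using LIMSEQ_subseq_LIMSEQ[OF steps r] by (simp add: o_def)
  \<comment> \<open>The trial points \<open>y (r i)\<close> share the limit \<open>xbar\<close>, so
    both arguments of \<open>H\<close> converge to it.\<close>
  have Hlim: "(\<lambda>i. H (y (r i)) (x (r i))) \<longlonglongrightarrow> H xbar xbar"
    unfolding H_def using improvement_tendsto_diag[OF f c _ lim] tendsto_add[OF ysteps lim] by simp
  have "\<forall>\<^sub>F i in sequentially. K \<le> r i"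
    using filterlim_subseq[OF r] by (simp add: filterlim_at_top)
  then have ev: "\<forall>\<^sub>F i in sequentially. \<mu> (r i) = \<mu> K"
    by (rule eventually_mono) (rule \<mu>)
  \<comment> \<open>For active \<open>a\<close> the left side equals \<open>Ma a xbar xbar\<close>,
    so \<open>xbar\<close> minimises the regularised piece over \<open>X\<close>.\<close>
  have prox: "H xbar xbar \<le> Ma a z xbar + \<mu> K / 2 * (norm (z - xbar))\<^sup>2"
    if a: "a \<in> active H Ma A xbar" and z: "z \<in> X" for a z
  proof -
    have "finite (active H Ma A xbar)"
      using model xbar by (simp add: is_model_def active_def)
    \<comment> \<open>The minimum over the finite active set lies below every active piece, which
      puts the graph point of that piece into the epigraph.\<close>
    then have "(z, Ma a z xbar) \<in> epi (\<lambda>z. ereal (Min ((\<lambda>a. Ma a z xbar) ` active H Ma A xbar)) + ind_fun X z)"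
      using a z unfolding epi_plus_ind_fun by (auto simp: epigraph_def)
    then have "(z, Ma a z xbar) \<in> LimInn (\<lambda>i. epi (\<lambda>w. ereal (M w (x (r i))) + ind_fun X w))"
      using inner by blast
    then show ?thesis
    \<comment> \<open>The rotation brings the inner-limit premise to the front, where the chained
      fact discharges it.\<close>
    proof (rule prox_inequality_limit[where H = H and M = M and X = X and v = "\<lambda>i. y (r i)"
          and u = "\<lambda>i. x (r i)" and m = "\<lambda>i. \<mu> (r i)" and e = "\<lambda>i. \<epsilon> (r i)" and lam = lam
          and \<mu>bar = \<mu>bar, rotated -1])
    qed (use run ev Hlim lim ysteps \<mu>bar[OF inX] in \<open>simp_all add: algorithm_run_def\<close>)
  qed
  have crit: "M_critical X H Ma A xbar"
    unfolding M_critical_def is_arg_min_linorder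
  proof (intro conjI ballI xbar allI impI)
    fix a z assume a: "a \<in> active H Ma A xbar" and z: "z \<in> X"
    have "convex_on UNIV (\<lambda>w. Ma a w xbar)"
      using model xbar a by (simp add: is_model_def active_def)
    then have "convex_on X (\<lambda>w. Ma a w xbar)"
      using \<open>convex X\<close> convex_on_subset by blast
    then show "Ma a xbar xbar \<le> Ma a z xbar"
    proof (rule convex_prox_minimizer_imp_minimizer[OF _ xbar z, where g = "\<lambda>w. Ma a w xbar"])
      show "Ma a xbar xbar \<le> Ma a w xbar + \<mu> K / 2 * (norm (w - xbar))\<^sup>2" if "w \<in> X" for w
        using prox[OF a that] a by (simp add: active_def)
    qed
  qed
  moreover have "feasible X c xbar" if "feasible X c (x 0)"
  proof -
    \<comment> \<open>Persistence from index 0 covers all iterates, and continuity of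
      \<open>c\<close> carries the inequality to the limit.\<close>
    have "c (x k) \<le> 0" for k
      using that constraint_satisfied_persists[OF run[unfolded H_def] \<open>\<rho> \<ge> 0\<close>, of 0] by (simp add: feasible_def)
    then have "c xbar \<le> 0"
      using isCont_tendsto_compose[OF c lim] by (intro LIMSEQ_le_const2) auto
    then show ?thesis using xbar by (simp add: feasible_def)
  qed
  ultimately show "M_critical X H Ma A xbar \<and>
           (feasible X c xbar \<longrightarrow> FM_critical X c H Ma A xbar) \<and>
           (feasible X c (x 0) \<longrightarrow> feasible X c xbar)"
    by (auto simp: FM_critical_def feasible_def)
qed

end
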